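(* Suppose there exist constants $\bar\Delta,\sigma>0$ such that for all $t\ge 0$: (i) the equilibrium drift $\bar\Delta_t=\|\bar x_t-\bar x_{t+1}\|$ satisfies $\mathbb{E}\,\bar\Delta_t^2\le\bar\Delta^2$; and (ii) the gradient noise satisfies $\mathbb{E}\|z_t\|^2\le\sigma^2$. Then the iterates $\{x_t\}$ generated by the decision-dependent proximal stochastic gradient method with constant step size $\eta_t\equiv\eta$, $0<\eta\le 1/(2L)$, satisfy, for all $t\ge 0$, $$\mathbb{E}\|x_t-\bar{x}_t\|^2 \leq (1-\bar{\mu}\eta)^t\|x_0-\bar{x}_0\|^2 + 2\left(\frac{\eta\sigma^2}{\bar\mu} + \left(\frac{\bar\Delta}{\bar{\mu}\eta}\right)^2\right).$$
   Context: Notation: $\mathbb{N}=\{0,1,2,\dots\}$; $\mathbb{R}^d$ carries the Euclidean inner product $\langle\cdot,\cdot\rangle$ and norm $\|\cdot\|$. Problem family. For each $t\in\mathbb{N}$ and $x\in\mathbb{R}^d$, $f_{t,x}\colon\mathbb{R}^d\to\mathbb{R}$ is $\mu$-strongly convex and $C^1$-smooth with $L$-Lipschitz gradient, for common constants $\mu,L>0$; $\nabla f_{t,x}(u)$ denotes the gradient of $f_{t,x}(\cdot)$ at $u$. For each $t$, $r_t\colon\mathbb{R}^d\to\mathbb{R}\cup\{\infty\}$ is proper, closed, convex. Set $$\gamma:=\sup_{t\in\mathbb{N},\,u,x,y\in\mathbb{R}^d,\,x\ne y}\frac{\|\nabla f_{t,x}(u)-\nabla f_{t,y}(u)\|}{\|x-y\|},$$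 and assume $\gamma<\mu$. Set $\bar\mu:=\mu-\gamma>0$. The functions may be random (the problem may evolve stochastically), with these conditions holding for every outcome with deterministic $\mu,L,\gamma$. Equilibria. For each $t$ there is a unique point $\bar x_t$ with $\bar x_t\in\operatorname{argmin}_{u\in\mathbb{R}^d}\{f_{t,\bar x_t}(u)+r_t(u)\}$. Algorithm (decision-dependent proximal stochastic gradient method). Given $x_0$ and step sizes $\eta_t>0$, at each step $t\ge0$ a stochastic gradient $g_t$ (estimator of $\nabla f_{t,x_t}(x_t)$) is obtained and $$x_{t+1}=\operatorname{prox}_{\eta_t r_t}(x_t-\eta_t g_t)=\operatorname{argmin}_{u\in\mathbb{R}^d}\left\{r_t(u)+\tfrac{1}{2\eta_t}\|u-(x_t-\eta_t g_t)\|^2\right\}.$$ The gradient noise is $z_t:=\nabla f_{t,x_t}(x_t)-g_t$. Stochastic framework. There is a probability space $(\Omega,\mathcal{F},\mathbb{P})$ with filtration $(\mathcal{F}_t)_{t\ge0}$, $\mathcal{F}_0=\{\emptyset,\Omega\}$, such that for all $t\ge0$: $x_t,\bar x_t\colon\Omega\to\mathbb{R}^d$ are $\mathcal{F}_t$-measurable, and $z_t\colon\Omega\to\mathbb{R}^d$ is $\mathcal{F}_{t+1}$-measurable with $\mathbb{E}[z_t\mid\mathcal{F}_t]=0$. *)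

theory Defs
  imports "HOL-Probability.Probability"
begin

definition gradient :: "('a::real_inner \<Rightarrow> real) \<Rightarrow> 'a \<Rightarrow> 'a" where
  "gradient f u = (THE g. GDERIV f u :> g)"

lemma gradient_eqI:
  assumes "GDERIV f u :> g"
  shows "gradient f u = g"
  unfolding gradient_def
proof (rule the_equality, rule assms)
  fix g'
  assume "GDERIV f u :> g'"
  then have "(\<lambda>h. inner h g') = (\<lambda>h. inner h g)"
    using assms unfolding gderiv_def by (rule has_derivative_unique)
  then have "inner (g' - g) (g' - g) = 0"
    by (metis inner_diff_right diff_self)
  then show "g' = g"
    by simp
qed

definition strongly_convex :: "real \<Rightarrow> ('a::real_inner \<Rightarrow> real) \<Rightarrow> bool" where
  "strongly_convex \<mu> f \<longleftrightarrow> convex_on UNIV (\<lambda>u. f u - \<mu> / 2 * (norm u)\<^sup>2)"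

definition C1_lipschitz_gradient :: "real \<Rightarrow> ('a::real_inner \<Rightarrow> real) \<Rightarrow> bool" where
  "C1_lipschitz_gradient L f \<longleftrightarrow>
     (\<forall>u. \<exists>g. GDERIV f u :> g) \<and> continuous_on UNIV (gradient f) \<and>
     L-lipschitz_on UNIV (gradient f)"

text \<open>The library's epigraph is restricted to real-valued functions; for an extended-real-valued
  function the epigraph still lives over the reals. A function is called closed (resp. convex) if
  its epigraph is.\<close>

definition ereal_epigraph :: "('a \<Rightarrow> ereal) \<Rightarrow> ('a \<times> real) set" where
  "ereal_epigraph r = {(u, a). r u \<le> ereal a}"

definition proper_closed_convex :: "('a::euclidean_space \<Rightarrow> ereal) \<Rightarrow> bool" where
  "proper_closed_convex r \<longleftrightarrow>
     (\<forall>u. r u \<noteq> -\<infinity>) \<and> (\<exists>u. r u \<noteq> \<infinity>) \<and>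
     closed (ereal_epigraph r) \<and> convex (ereal_epigraph r)"

definition argmin :: "('a \<Rightarrow> ereal) \<Rightarrow> 'a set" where
  "argmin h = {u. is_arg_min h (\<lambda>_. True) u}"

text \<open>Set-valued; a singleton whenever \<open>\<eta>\<close> is positive and \<open>r\<close> is proper, closed and convex.\<close>

definition prox :: "real \<Rightarrow> ('a::real_inner \<Rightarrow> ereal) \<Rightarrow> 'a \<Rightarrow> 'a set" where
  "prox \<eta> r v = argmin (\<lambda>u. r u + ereal (1 / (2 * \<eta>) * (norm (u - v))\<^sup>2))"

text \<open>Here \<open>\<phi> x\<close> is the smooth objective at decision \<open>x\<close>.\<close>

definition is_equilibrium ::
  "('a \<Rightarrow> 'a \<Rightarrow> real) \<Rightarrow> ('a \<Rightarrow> ereal) \<Rightarrow> 'a \<Rightarrow> bool" where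
  "is_equilibrium \<phi> r y \<longleftrightarrow> y \<in> argmin (\<lambda>u. ereal (\<phi> y u) + r u)"

text \<open>In \<open>f \<omega> t x u\<close> the arguments are the outcome, the time, the decision and the evaluation point.
  The supremum is also over outcomes, so it is a deterministic constant, and it is taken in the
  extended reals, so it is \<open>\<infinity>\<close> when the quotients are unbounded.\<close>

definition decision_sensitivity ::
  "'w set \<Rightarrow> ('w \<Rightarrow> nat \<Rightarrow> 'a::real_inner \<Rightarrow> 'a \<Rightarrow> real) \<Rightarrow> ereal" where
  "decision_sensitivity \<Omega> f =
     Sup {ereal (norm (gradient (f \<omega> t x) u - gradient (f \<omega> t y) u) / norm (x - y))
          | \<omega> t u x y. \<omega> \<in> \<Omega> \<and> x \<noteq> y}"

text \<open>The library's conditional expectation is for real-valued random variables; it is extended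
  coordinatewise.\<close>

definition vec_cond_exp ::
  "'w measure \<Rightarrow> 'w measure \<Rightarrow> ('w \<Rightarrow> 'a::euclidean_space) \<Rightarrow> 'w \<Rightarrow> 'a" where
  "vec_cond_exp M G Z \<omega> =
     (\<Sum>b\<in>Basis. real_cond_exp M G (\<lambda>\<omega>'. Z \<omega>' \<bullet> b) \<omega> *\<^sub>R b)"

end

theory Submission
  imports Defs
begin

text \<open>Adding the first-order optimality conditions of the proximal step and of the equilibrium
  \<open>xbar t\<close>, and bounding gradient differences by strong convexity, the descent lemma and the
  sensitivity \<open>\<gamma>\<close>, gives with \<open>\<epsilon> = \<mu>bar * \<eta>\<close> the pathwise estimate
  \<open>(1 + \<epsilon>) * (norm (x (Suc t) - xbar t))\<^sup>2 \<le> (1 - \<epsilon>) * (norm (x t - xbar t))\<^sup>2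
    + 2 * \<eta> * (z t \<bullet> (x t - xbar t)) + 2 * \<eta>\<^sup>2 * (norm (z t))\<^sup>2\<close>.
  The cross term has expectation zero. Young's inequality with weight \<open>\<epsilon>\<close> replaces \<open>xbar t\<close> by
  \<open>xbar (Suc t)\<close>; it consumes exactly the factor \<open>1 + \<epsilon>\<close> on the left and costs
  \<open>(1 + 1 / \<epsilon>) * \<Delta>\<^sup>2 \<le> (2 / \<epsilon>) * \<Delta>\<^sup>2\<close>, as \<open>\<epsilon> \<le> L * \<eta> \<le> 1\<close>. Iterating the resulting
  contraction with factor \<open>1 - \<epsilon>\<close> sums the noise and drift terms to the stated constant.\<close>

section \<open>Directional derivatives and quadratic bounds for smooth functions\<close>

lemma GDERIV_along_line:
  assumes "GDERIV \<phi> (p + s *\<^sub>R d) :> g"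
  shows "((\<lambda>s. \<phi> (p + s *\<^sub>R d)) has_real_derivative (g \<bullet> d)) (at s)"
proof -
  have "((\<lambda>s. p + s *\<^sub>R d) has_derivative (\<lambda>s. s *\<^sub>R d)) (at s)"
    by (auto intro!: derivative_eq_intros)
  from has_derivative_compose[OF this assms[unfolded gderiv_def]]
  show ?thesis
    by (simp add: has_field_derivative_def inner_commute mult_commute_abs)
qed

text \<open>The difference quotients at small positive \<open>s\<close> are at least
  \<open>k\<close>, and so is their one-sided limit. Convexity and minimality both supply lower
  bounds of this shape along a segment.\<close>

lemma GDERIV_directional_ge:
  assumes "GDERIV \<phi> p :> g"
    and "\<And>s. 0 < s \<Longrightarrow> s < 1 \<Longrightarrow> \<phi> p + s * k \<le> \<phi> (p + s *\<^sub>R d)"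
  shows "k \<le> g \<bullet> d"
proof -
  have "((\<lambda>s. \<phi> (p + s *\<^sub>R d)) has_real_derivative (g \<bullet> d)) (at 0)"
    using assms(1) by (intro GDERIV_along_line) simp
  then have "((\<lambda>s. (\<phi> (p + s *\<^sub>R d) - \<phi> p) / s) \<longlongrightarrow> g \<bullet> d) (at 0)"
    by (simp add: has_field_derivative_iff)
  then have "((\<lambda>s. (\<phi> (p + s *\<^sub>R d) - \<phi> p) / s) \<longlongrightarrow> g \<bullet> d) (at_right 0)"
    by (rule filterlim_mono) (auto intro: at_le)
  then show ?thesis
  proof (rule tendsto_lowerbound)
    have "\<forall>\<^sub>F s in at_right (0::real). s \<in> {0<..<1}"
      by (rule eventually_at_right_real) simp
    then show "\<forall>\<^sub>F s in at_right 0. k \<le> (\<phi> (p + s *\<^sub>R d) - \<phi> p) / s"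
    proof eventually_elim
      case (elim s)
      then show ?case
        using assms(2)[of s] by (simp add: field_simps)
    qed
  qed simp
qed

lemma convex_on_GDERIV_ge:
  assumes "convex_on UNIV h" and "GDERIV h p :> g"
  shows "h p + g \<bullet> (u - p) \<le> h u"
proof -
  have "h p - h u \<le> (- g) \<bullet> (u - p)"
  \<comment> \<open>Convexity bounds \<open>h\<close> from above along the segment, so the
    lower-bound criterion is applied to \<open>- h\<close>.\<close>
  proof (rule GDERIV_directional_ge)
    show "GDERIV (\<lambda>u. - h u) p :> - g"
      using assms(2) by (rule GDERIV_minus)
    fix s :: real
    assume s: "0 < s" "s < 1"
    have "h (p + s *\<^sub>R (u - p)) = h ((1 - s) *\<^sub>R p + s *\<^sub>R u)"
      by (simp add: algebra_simps)
    also have "\<dots> \<le> (1 - s) * h p + s * h u"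
      using assms(1) s by (intro convex_onD) auto
    finally show "- h p + s * (h p - h u) \<le> - h (p + s *\<^sub>R (u - p))"
      by (simp add: algebra_simps)
  qed
  then show ?thesis
    by simp
qed

lemma GDERIV_norm_diff_sq: "GDERIV (\<lambda>u. c * (norm (u - v))\<^sup>2) p :> (2 * c) *\<^sub>R (p - v)"
  unfolding gderiv_def power2_norm_eq_inner
  by (auto intro!: derivative_eq_intros simp: inner_commute algebra_simps)

lemma strongly_convex_GDERIV_ge:
  assumes "strongly_convex \<mu> f" and "GDERIV f p :> g"
  shows "f p + g \<bullet> (u - p) + \<mu> / 2 * (norm (u - p))\<^sup>2 \<le> f u"
proof -
  have "GDERIV (\<lambda>u. f u - \<mu> / 2 * (norm u)\<^sup>2) p :> g - \<mu> *\<^sub>R p"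
    using GDERIV_diff[OF assms(2) GDERIV_norm_diff_sq[of "\<mu> / 2" 0 p]] by simp
  from convex_on_GDERIV_ge[OF assms(1)[unfolded strongly_convex_def] this, of u]
  show ?thesis
    by (simp add: power2_norm_eq_inner inner_commute algebra_simps)
qed

lemma C1_lipschitz_gradient_GDERIV:
  assumes "C1_lipschitz_gradient L f"
  shows "GDERIV f u :> gradient f u"
  using assms gradient_eqI unfolding C1_lipschitz_gradient_def by metis

lemma C1_lipschitz_gradient_norm_le:
  assumes "C1_lipschitz_gradient L f"
  shows "norm (gradient f u - gradient f v) \<le> L * norm (u - v)"
  using assms unfolding C1_lipschitz_gradient_def
  by (auto dest: lipschitz_onD simp flip: dist_norm)

lemma C1_lipschitz_gradient_descent:
  assumes "C1_lipschitz_gradient L f"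
  shows "f u \<le> f p + gradient f p \<bullet> (u - p) + L / 2 * (norm (u - p))\<^sup>2"
proof -
  define d where "d = u - p"
  \<comment> \<open>\<open>\<psi>\<close> is \<open>f\<close> along the segment minus its claimed
    quadratic upper model. The Lipschitz gradient makes its derivative nonpositive on [0,1], so
    comparing the endpoints gives the bound without integration.\<close>
  define \<psi> where "\<psi> s = f (p + s *\<^sub>R d) - s * (gradient f p \<bullet> d) - L / 2 * s\<^sup>2 * (norm d)\<^sup>2"
    for s :: real
  have "\<psi> 1 \<le> \<psi> 0"
  proof (rule DERIV_nonpos_imp_nonincreasing[where f = \<psi>])
    fix s :: real
    assume s: "0 \<le> s" "s \<le> 1"
    let ?D = "(gradient f (p + s *\<^sub>R d) - gradient f p) \<bullet> d - L * s * (norm d)\<^sup>2"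
    have "((\<lambda>s. f (p + s *\<^sub>R d)) has_real_derivative gradient f (p + s *\<^sub>R d) \<bullet> d) (at s)"
      by (rule GDERIV_along_line[OF C1_lipschitz_gradient_GDERIV[OF assms]])
    then have "(\<psi> has_real_derivative ?D) (at s)"
      unfolding \<psi>_def
      by (auto intro!: derivative_eq_intros simp: algebra_simps)
    moreover have "?D \<le> 0"
    proof -
      have "(gradient f (p + s *\<^sub>R d) - gradient f p) \<bullet> d
          \<le> norm (gradient f (p + s *\<^sub>R d) - gradient f p) * norm d"
        by (rule norm_cauchy_schwarz)
      also have "\<dots> \<le> (L * (s * norm d)) * norm d"
        using C1_lipschitz_gradient_norm_le[OF assms, of "p + s *\<^sub>R d" p] s
        by (intro mult_right_mono) auto
      finally show ?thesis
        by (simp add: power2_eq_square algebra_simps)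
    qed
    ultimately show "\<exists>y. (\<psi> has_real_derivative y) (at s) \<and> y \<le> 0"
      by blast
  qed simp
  then show ?thesis
    by (simp add: \<psi>_def d_def)
qed

text \<open>The quadratic lower and upper models at \<open>0\<close> are compared at a unit vector,
  where only their curvatures differ. This later keeps the contraction factor nonnegative.\<close>

lemma strong_convexity_le_lipschitz:
  fixes f :: "'a::euclidean_space \<Rightarrow> real"
  assumes "strongly_convex \<mu> f" and "C1_lipschitz_gradient L f"
  shows "\<mu> \<le> L"
proof -
  obtain b :: 'a where b: "b \<in> Basis"
    using nonempty_Basis by blast
  have "f 0 + gradient f 0 \<bullet> b + \<mu> / 2 \<le> f b"
    using strongly_convex_GDERIV_ge[OF assms(1) C1_lipschitz_gradient_GDERIV[OF assms(2)], of 0 b] b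
    by simp
  moreover have "f b \<le> f 0 + gradient f 0 \<bullet> b + L / 2"
    using C1_lipschitz_gradient_descent[OF assms(2), of b 0] b by simp
  ultimately show ?thesis
    by simp
qed

section \<open>First-order optimality for composite objectives\<close>

lemma argmin_finite:
  assumes "proper_closed_convex r" and "p \<in> argmin (\<lambda>u. ereal (\<phi> u) + r u)"
  obtains a where "r p = ereal a"
proof -
  obtain u where "r u \<noteq> \<infinity>"
    using assms(1) by (auto simp: proper_closed_convex_def)
  moreover have "\<not> ereal (\<phi> u) + r u < ereal (\<phi> p) + r p"
    using assms(2) by (simp add: argmin_def is_arg_min_def)
  \<comment> \<open>A point where \<open>r\<close> is finite has a finite objective, which a
    minimiser with \<open>r p = \<infinity>\<close> could not match.\<close>
  ultimately have "r p \<noteq> \<infinity>"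
    by (cases "r u") auto
  moreover have "r p \<noteq> -\<infinity>"
    using assms(1) by (simp add: proper_closed_convex_def)
  ultimately show ?thesis
    using that by (cases "r p") auto
qed

text \<open>This is the subgradient inequality for \<open>- g\<close> at \<open>p\<close>: a short
  move towards \<open>u\<close> raises \<open>r\<close> by at most \<open>s * (c - a)\<close>, so
  minimality limits the decrease of \<open>\<phi>\<close>, which need not be convex.\<close>

lemma argmin_variational_inequality:
  assumes r: "proper_closed_convex r" and p: "p \<in> argmin (\<lambda>u. ereal (\<phi> u) + r u)"
    and \<phi>: "GDERIV \<phi> p :> g"
    and a: "r p = ereal a" and c: "r u = ereal c"
  shows "a - g \<bullet> (u - p) \<le> c"
proof -
  have "a - c \<le> g \<bullet> (u - p)"
  proof (rule GDERIV_directional_ge[OF \<phi>])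
    fix s :: real
    assume s: "0 < s" "s < 1"
    let ?q = "p + s *\<^sub>R (u - p)"
    \<comment> \<open>Convexity of \<open>r\<close> is convexity of its epigraph, so the chord bound
      is a convex combination of two epigraph points.\<close>
    have "(1 - s) *\<^sub>R (p, a) + s *\<^sub>R (u, c) \<in> ereal_epigraph r"
      using r a c s unfolding proper_closed_convex_def
      by (intro convexD) (auto simp: ereal_epigraph_def)
    moreover have "(1 - s) *\<^sub>R (p, a) + s *\<^sub>R (u, c) = (?q, (1 - s) * a + s * c)"
      by (simp add: algebra_simps)
    ultimately have "r ?q \<le> ereal ((1 - s) * a + s * c)"
      by (simp add: ereal_epigraph_def)
    moreover have "ereal (\<phi> p) + r p \<le> ereal (\<phi> ?q) + r ?q"
      using p by (simp add: argmin_def is_arg_min_def not_less)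
    ultimately have "ereal (\<phi> p) + ereal a \<le> ereal (\<phi> ?q) + ereal ((1 - s) * a + s * c)"
      unfolding a by (meson add_left_mono order_trans)
    then show "\<phi> p + s * (a - c) \<le> \<phi> ?q"
      by (simp add: algebra_simps)
  qed
  then show ?thesis
    by simp
qed

section \<open>Decision sensitivity and the pathwise one-step estimate\<close>

lemma decision_sensitivity_bound:
  assumes "ereal \<gamma> = decision_sensitivity \<Omega> f" and "\<omega> \<in> \<Omega>"
  shows "norm (gradient (f \<omega> t x) u - gradient (f \<omega> t y) u) \<le> \<gamma> * norm (x - y)"
proof (cases "x = y")
  case False
  have "ereal (norm (gradient (f \<omega> t x) u - gradient (f \<omega> t y) u) / norm (x - y)) \<le> ereal \<gamma>"
    unfolding assms(1) decision_sensitivity_def using False assms(2)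
    by (intro Sup_upper) blast
  then show ?thesis
    using False by (simp add: field_simps)
qed simp

lemma decision_sensitivity_nonneg:
  fixes f :: "'w \<Rightarrow> nat \<Rightarrow> 'a::euclidean_space \<Rightarrow> 'a \<Rightarrow> real"
  assumes "ereal \<gamma> = decision_sensitivity \<Omega> f" and "\<omega> \<in> \<Omega>"
  shows "0 \<le> \<gamma>"
proof -
  obtain b :: 'a where "b \<in> Basis"
    using nonempty_Basis by blast
  then have "norm b = 1"
    by simp
  then show ?thesis
    \<comment> \<open>Any distinct pair of decisions would do; \<open>b\<close> and \<open>0\<close>
      are at distance one, and the time \<open>undefined\<close> is arbitrary.\<close>
    using decision_sensitivity_bound[OF assms, of undefined b 0 0] norm_ge_zero
    by (metis diff_zero mult.right_neutral order_trans)
qed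

text \<open>The noise is paired with \<open>x - y\<close> rather than \<open>x' - y\<close> because
  only the former is known before the noise is drawn. The price \<open>z \<bullet> (x' - x)\<close>
  is absorbed by the squared step length, which the restriction on \<open>\<eta>\<close> leaves
  available.\<close>

lemma prox_gradient_step:
  fixes \<phi> :: "'a::euclidean_space \<Rightarrow> 'a \<Rightarrow> real"
  assumes sc: "strongly_convex \<mu> (\<phi> x)"
    and C1: "\<And>y. C1_lipschitz_gradient L (\<phi> y)"
    and r: "proper_closed_convex r"
    and sens: "norm (gradient (\<phi> x) y - gradient (\<phi> y) y) \<le> \<gamma> * norm (x - y)"
    and "0 \<le> \<gamma>"
    and eq: "is_equilibrium \<phi> r y"
    and \<eta>: "0 < \<eta>" "L * \<eta> \<le> 1 / 2"
    and x': "x' \<in> prox \<eta> r (x - \<eta> *\<^sub>R (gradient (\<phi> x) x - z))"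
  shows "(1 + (\<mu> - \<gamma>) * \<eta>) * (norm (x' - y))\<^sup>2
    \<le> (1 - (\<mu> - \<gamma>) * \<eta>) * (norm (x - y))\<^sup>2 + 2 * \<eta> * (z \<bullet> (x - y)) + 2 * \<eta>\<^sup>2 * (norm z)\<^sup>2"
proof -
  define v where "v = x - \<eta> *\<^sub>R (gradient (\<phi> x) x - z)"
  let ?A = "(norm (x - y))\<^sup>2" and ?B = "(norm (x' - y))\<^sup>2" and ?C = "(norm (x' - x))\<^sup>2"
  have y: "y \<in> argmin (\<lambda>u. ereal (\<phi> y u) + r u)"
    using eq by (simp add: is_equilibrium_def)
  have x'_min: "x' \<in> argmin (\<lambda>u. ereal (1 / (2 * \<eta>) * (norm (u - v))\<^sup>2) + r u)"
    using x' by (simp add: prox_def v_def add.commute)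
  obtain a where a: "r y = ereal a"
    by (rule argmin_finite[OF r y])
  obtain c where c: "r x' = ereal c"
    by (rule argmin_finite[OF r x'_min])
  \<comment> \<open>Each minimiser is tested against the other, so the values of \<open>r\<close>
    cancel on addition.\<close>
  have "a - gradient (\<phi> y) y \<bullet> (x' - y) \<le> c"
    by (rule argmin_variational_inequality[OF r y C1_lipschitz_gradient_GDERIV[OF C1] a c])
  moreover have "c - ((2 * (1 / (2 * \<eta>))) *\<^sub>R (x' - v)) \<bullet> (y - x') \<le> a"
    by (rule argmin_variational_inequality[OF r x'_min GDERIV_norm_diff_sq c a])
  ultimately have "\<eta> * (- gradient (\<phi> y) y \<bullet> (x' - y)) \<le> \<eta> * ((1 / \<eta>) * ((x' - v) \<bullet> (y - x')))"
    using \<eta> by (intro mult_left_mono) auto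
  then have "\<eta> * (- gradient (\<phi> y) y \<bullet> (x' - y)) \<le> (x' - v) \<bullet> (y - x')"
    using \<eta> by simp
  \<comment> \<open>Three-point identity: polarisation turns the inner product of
    \<open>x' - x\<close> and \<open>y - x'\<close> into squared distances.\<close>
  also have "(x' - v) \<bullet> (y - x')
      = (?A - ?B - ?C) / 2 - \<eta> * ((gradient (\<phi> x) x - z) \<bullet> (x' - y))"
    unfolding v_def power2_norm_eq_inner
    by (simp add: inner_commute algebra_simps) (simp add: field_simps)
  finally have opt: "\<eta> * ((gradient (\<phi> x) x - gradient (\<phi> y) y) \<bullet> (x' - y))
      - \<eta> * (z \<bullet> (x' - y)) \<le> (?A - ?B - ?C) / 2"
    unfolding inner_diff_left inner_minus_left right_diff_distrib by linarith
  \<comment> \<open>Function values cancel along the chain \<open>x\<close>, \<open>y\<close>,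
    \<open>x'\<close>: strong convexity from \<open>x\<close> to \<open>y\<close> and from
    \<open>y\<close> to \<open>x'\<close>, then descent from \<open>x\<close> to
    \<open>x'\<close>.\<close>
  have "\<phi> x x + gradient (\<phi> x) x \<bullet> (y - x) + \<mu> / 2 * ?A \<le> \<phi> x y"
    using strongly_convex_GDERIV_ge[OF sc C1_lipschitz_gradient_GDERIV[OF C1], of x y]
    by (simp add: norm_minus_commute)
  moreover have "\<phi> x y + gradient (\<phi> x) y \<bullet> (x' - y) + \<mu> / 2 * ?B \<le> \<phi> x x'"
    by (rule strongly_convex_GDERIV_ge[OF sc C1_lipschitz_gradient_GDERIV[OF C1]])
  moreover have "\<phi> x x' \<le> \<phi> x x + gradient (\<phi> x) x \<bullet> (x' - x) + L / 2 * ?C"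
    by (rule C1_lipschitz_gradient_descent[OF C1])
  ultimately have mono: "\<mu> / 2 * ?A + \<mu> / 2 * ?B - L / 2 * ?C
      \<le> (gradient (\<phi> x) x - gradient (\<phi> x) y) \<bullet> (x' - y)"
    by (simp add: algebra_simps)
  \<comment> \<open>Changing the decision from \<open>x\<close> to \<open>y\<close> at the fixed
    point \<open>y\<close> costs a product of distances; splitting it evenly lowers
    \<open>\<mu>\<close> to \<open>\<mu> - \<gamma>\<close> in both coefficients.\<close>
  have "- ((gradient (\<phi> x) y - gradient (\<phi> y) y) \<bullet> (x' - y))
      \<le> norm (gradient (\<phi> x) y - gradient (\<phi> y) y) * norm (x' - y)"
    using Cauchy_Schwarz_ineq2[of "gradient (\<phi> x) y - gradient (\<phi> y) y" "x' - y"] by linarith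
  also have "\<dots> \<le> \<gamma> * norm (x - y) * norm (x' - y)"
    using sens by (intro mult_right_mono) auto
  also have "\<dots> \<le> \<gamma> * ((?A + ?B) / 2)"
    using \<open>0 \<le> \<gamma>\<close> sum_squares_bound[of "norm (x - y)" "norm (x' - y)"]
    unfolding mult.assoc by (intro mult_left_mono) auto
  finally have "(\<mu> - \<gamma>) / 2 * ?A + (\<mu> - \<gamma>) / 2 * ?B - L / 2 * ?C
      \<le> (gradient (\<phi> x) x - gradient (\<phi> y) y) \<bullet> (x' - y)"
    using mono by (simp add: algebra_simps add_divide_distrib diff_divide_distrib)
  then have "\<eta> * ((\<mu> - \<gamma>) / 2 * ?A + (\<mu> - \<gamma>) / 2 * ?B - L / 2 * ?C) \<le>
      \<eta> * ((gradient (\<phi> x) x - gradient (\<phi> y) y) \<bullet> (x' - y))"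
    using \<eta> by (intro mult_left_mono) auto
  with opt have main: "(1 + (\<mu> - \<gamma>) * \<eta>) * ?B
      \<le> (1 - (\<mu> - \<gamma>) * \<eta>) * ?A - (1 - L * \<eta>) * ?C + 2 * \<eta> * (z \<bullet> (x' - y))"
    by (simp add: field_simps)
  \<comment> \<open>The square is completed with weight 1/2 on \<open>?C\<close>, which is what
    \<open>1 - L * \<eta> \<ge> 1 / 2\<close> can pay for.\<close>
  have "2 * \<eta> * (z \<bullet> (x' - x)) \<le> 2 * \<eta>\<^sup>2 * (norm z)\<^sup>2 + ?C / 2"
  proof -
    have "0 \<le> (norm (2 *\<^sub>R \<eta> *\<^sub>R z - (x' - x)))\<^sup>2 / 2"
      by simp
    also have "\<dots> = 2 * \<eta>\<^sup>2 * (norm z)\<^sup>2 - 2 * \<eta> * (z \<bullet> (x' - x)) + ?C / 2"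
      unfolding power2_norm_eq_inner
      by (simp add: inner_commute algebra_simps power2_eq_square) (simp add: field_simps)
    finally show ?thesis
      by simp
  qed
  moreover have "1 / 2 * ?C \<le> (1 - L * \<eta>) * ?C"
    using \<eta> by (intro mult_right_mono) auto
  moreover have "2 * \<eta> * (z \<bullet> (x' - y)) = 2 * \<eta> * (z \<bullet> (x - y)) + 2 * \<eta> * (z \<bullet> (x' - x))"
    by (simp add: algebra_simps)
  ultimately show ?thesis
    using main by linarith
qed

lemma norm_diff_sq_young:
  fixes a b c :: "'a::real_inner"
  assumes "0 < \<epsilon>"
  shows "(norm (a - c))\<^sup>2 \<le> (1 + \<epsilon>) * (norm (a - b))\<^sup>2 + (1 + 1 / \<epsilon>) * (norm (b - c))\<^sup>2"
proof -
  let ?u = "norm (a - b)" and ?v = "norm (b - c)"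
  have "(norm (a - c))\<^sup>2 \<le> (?u + ?v)\<^sup>2"
    using norm_triangle_ineq[of "a - b" "b - c"] by (intro power_mono) auto
  \<comment> \<open>The gap in Young's inequality is an exact square divided by
    \<open>\<epsilon>\<close>.\<close>
  moreover have "(1 + \<epsilon>) * ?u\<^sup>2 + (1 + 1 / \<epsilon>) * ?v\<^sup>2 - (?u + ?v)\<^sup>2 = (\<epsilon> * ?u - ?v)\<^sup>2 / \<epsilon>"
    using assms by (simp add: field_simps power2_eq_square)
  moreover have "0 \<le> (\<epsilon> * ?u - ?v)\<^sup>2 / \<epsilon>"
    using assms by simp
  ultimately show ?thesis
    by linarith
qed

section \<open>Second moments, conditional expectation and a scalar recursion\<close>

lemma integrable_inner_of_sq:
  fixes Y Z :: "'w \<Rightarrow> 'a::euclidean_space"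
  assumes [measurable]: "Y \<in> borel_measurable M" "Z \<in> borel_measurable M"
    and Y: "integrable M (\<lambda>\<omega>. (norm (Y \<omega>))\<^sup>2)" and Z: "integrable M (\<lambda>\<omega>. (norm (Z \<omega>))\<^sup>2)"
  shows "integrable M (\<lambda>\<omega>. Z \<omega> \<bullet> Y \<omega>)"
proof (rule Bochner_Integration.integrable_bound)
  show "integrable M (\<lambda>\<omega>. (norm (Y \<omega>))\<^sup>2 + (norm (Z \<omega>))\<^sup>2)"
    using Y Z by simp
  have "norm (Z \<omega> \<bullet> Y \<omega>) \<le> norm ((norm (Y \<omega>))\<^sup>2 + (norm (Z \<omega>))\<^sup>2)" for \<omega>
    using Cauchy_Schwarz_ineq2[of "Z \<omega>" "Y \<omega>"]
      sum_squares_bound[of "norm (Z \<omega>)" "norm (Y \<omega>)"] norm_ge_zero[of "Z \<omega>"] norm_ge_zero[of "Y \<omega>"]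
    by (simp add: power2_eq_square)
  then show "AE \<omega> in M. norm (Z \<omega> \<bullet> Y \<omega>) \<le> norm ((norm (Y \<omega>))\<^sup>2 + (norm (Z \<omega>))\<^sup>2)"
    by simp
qed measurable

lemma vec_cond_exp_inner_Basis:
  "b \<in> Basis \<Longrightarrow> vec_cond_exp M G Z \<omega> \<bullet> b = real_cond_exp M G (\<lambda>\<omega>'. Z \<omega>' \<bullet> b) \<omega>"
  by (simp add: vec_cond_exp_def inner_sum_left_Basis)

text \<open>Coordinatewise, the \<open>G\<close>-measurable factor is pulled out of the conditional
  expectation of the other, which vanishes almost everywhere. Square integrability makes each
  product integrable, as this requires.\<close>

lemma (in prob_space) integral_inner_cond_exp_zero:
  fixes Y Z :: "'a \<Rightarrow> 'b::euclidean_space"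
  assumes G: "subalgebra M G"
    and Y [measurable]: "Y \<in> borel_measurable G" and Z [measurable]: "Z \<in> borel_measurable M"
    and Y2: "integrable M (\<lambda>\<omega>. (norm (Y \<omega>))\<^sup>2)" and Z2: "integrable M (\<lambda>\<omega>. (norm (Z \<omega>))\<^sup>2)"
    and ce: "AE \<omega> in M. vec_cond_exp M G Z \<omega> = 0"
  shows "(\<integral>\<omega>. Z \<omega> \<bullet> Y \<omega> \<partial>M) = 0"
proof -
  interpret finite_measure_subalgebra M G
    using G by unfold_locales
  have YM [measurable]: "Y \<in> borel_measurable M"
    using measurable_from_subalg[OF G Y] .
  have comp_sq: "integrable M (\<lambda>\<omega>. (norm (X \<omega> \<bullet> b))\<^sup>2)"
    if [measurable]: "X \<in> borel_measurable M" and X2: "integrable M (\<lambda>\<omega>. (norm (X \<omega>))\<^sup>2)"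
      and b: "b \<in> Basis" for X :: "'a \<Rightarrow> 'b" and b
    by (rule Bochner_Integration.integrable_bound[OF X2])
      (auto intro!: AE_I2 power_mono Basis_le_norm[OF b] simp flip: abs_le_square_iff)
  have comp: "integrable M (\<lambda>\<omega>. (Y \<omega> \<bullet> b) * (Z \<omega> \<bullet> b))
      \<and> (\<integral>\<omega>. (Y \<omega> \<bullet> b) * (Z \<omega> \<bullet> b) \<partial>M) = 0" if b: "b \<in> Basis" for b
  proof
    show int: "integrable M (\<lambda>\<omega>. (Y \<omega> \<bullet> b) * (Z \<omega> \<bullet> b))"
      using integrable_inner_of_sq[of "\<lambda>\<omega>. Z \<omega> \<bullet> b" M "\<lambda>\<omega>. Y \<omega> \<bullet> b"]
        comp_sq[OF YM Y2 b] comp_sq[OF Z Z2 b] by simp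
    have "(\<integral>\<omega>. (Y \<omega> \<bullet> b) * (Z \<omega> \<bullet> b) \<partial>M)
        = (\<integral>\<omega>. (Y \<omega> \<bullet> b) * real_cond_exp M G (\<lambda>\<omega>. Z \<omega> \<bullet> b) \<omega> \<partial>M)"
      by (rule real_cond_exp_intg(2)[OF int, symmetric]) measurable
    also have "\<dots> = (\<integral>\<omega>. 0 \<partial>M)"
    proof (rule integral_cong_AE)
      show "AE \<omega> in M. (Y \<omega> \<bullet> b) * real_cond_exp M G (\<lambda>\<omega>. Z \<omega> \<bullet> b) \<omega> = 0"
        using ce by eventually_elim (simp flip: vec_cond_exp_inner_Basis[OF b])
    qed measurable
    finally show "(\<integral>\<omega>. (Y \<omega> \<bullet> b) * (Z \<omega> \<bullet> b) \<partial>M) = 0"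
      by simp
  qed
  have "(\<integral>\<omega>. Z \<omega> \<bullet> Y \<omega> \<partial>M) = (\<integral>\<omega>. (\<Sum>b\<in>Basis. (Y \<omega> \<bullet> b) * (Z \<omega> \<bullet> b)) \<partial>M)"
    by (simp add: euclidean_inner[of "Z _" "Y _"] mult.commute)
  also have "\<dots> = 0"
    using comp by (subst Bochner_Integration.integral_sum) auto
  finally show ?thesis .
qed

text \<open>Singletons are closed in a T1 space, so the fibre through \<open>\<omega>\<close> is
  measurable; being nonempty, it is the whole space.\<close>

lemma measurable_trivial_sigma_constant:
  fixes X :: "'w \<Rightarrow> 'a::t1_space"
  assumes "X \<in> borel_measurable G" and "sets G = {{}, space G}"
    and "\<omega> \<in> space G" and "\<omega>' \<in> space G"
  shows "X \<omega> = X \<omega>'"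
proof -
  have "X -` {X \<omega>} \<inter> space G \<in> sets G"
    using assms(1) by (rule measurable_sets) simp
  then have "X -` {X \<omega>} \<inter> space G = space G"
    using assms by auto
  then have "\<omega>' \<in> X -` {X \<omega>}"
    using assms(4) by blast
  then show ?thesis
    by simp
qed

text \<open>Moment bounds stated with the nonnegative integral already contain finiteness, hence
  integrability.\<close>

lemma integrable_nonneg_of_nn_integral_le:
  assumes [measurable]: "h \<in> borel_measurable M"
    and "\<And>\<omega>. 0 \<le> h \<omega>" and "(\<integral>\<^sup>+ \<omega>. ennreal (h \<omega>) \<partial>M) \<le> ennreal c" and "0 \<le> c"
  shows "integrable M h" and "(\<integral>\<omega>. h \<omega> \<partial>M) \<le> c"
proof -
  show int: "integrable M h"
    using assms by (intro integrableI_nonneg) (auto intro: le_less_trans)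
  then have "ennreal (\<integral>\<omega>. h \<omega> \<partial>M) \<le> ennreal c"
    using assms by (simp add: nn_integral_eq_integral)
  then show "(\<integral>\<omega>. h \<omega> \<partial>M) \<le> c"
    using assms by simp
qed

text \<open>\<open>B\<close> is a supersolution of the affine recursion, so induction replaces the
  summation of a geometric series; \<open>0 \<le> B\<close> serves the base case.\<close>

lemma contraction_recursion_bound:
  fixes q c B :: real
  assumes "e 0 = E" and "\<And>t. e (Suc t) \<le> q * e t + c" and "0 \<le> q" and "q * B + c \<le> B" and "0 \<le> B"
  shows "e t \<le> q ^ t * E + B"
proof (induction t)
  case 0
  then show ?case
    using assms by simp
next
  case (Suc t)
  have "e (Suc t) \<le> q * (q ^ t * E + B) + c"
    using assms(2)[of t] mult_left_mono[OF Suc assms(3)] by linarith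
  also have "\<dots> \<le> q ^ Suc t * E + B"
    using assms(4) by (simp add: algebra_simps)
  finally show ?case .
qed

section \<open>The expected squared tracking error\<close>

theorem corollary27:
  fixes M :: "'w measure"
    and F :: "nat \<Rightarrow> 'w measure"
    and f :: "'w \<Rightarrow> nat \<Rightarrow> 'a::euclidean_space \<Rightarrow> 'a \<Rightarrow> real"
    and r :: "'w \<Rightarrow> nat \<Rightarrow> 'a \<Rightarrow> ereal"
    and x xbar g z :: "nat \<Rightarrow> 'w \<Rightarrow> 'a"
    and \<mu> L \<gamma> \<mu>bar \<eta> \<Delta> \<sigma> :: real
  assumes "prob_space M"
    and "filtration (space M) F"
    and "\<And>t. subalgebra M (F t)"
    and "sets (F 0) = {{}, space M}"
    and "\<mu> > 0" and "L > 0"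
    and "\<And>\<omega> t y. \<omega> \<in> space M \<Longrightarrow> strongly_convex \<mu> (f \<omega> t y)"
    and "\<And>\<omega> t y. \<omega> \<in> space M \<Longrightarrow> C1_lipschitz_gradient L (f \<omega> t y)"
    and "\<And>\<omega> t. \<omega> \<in> space M \<Longrightarrow> proper_closed_convex (r \<omega> t)"
    and "ereal \<gamma> = decision_sensitivity (space M) f"
    and "\<gamma> < \<mu>"
    and "\<mu>bar = \<mu> - \<gamma>"
    and "\<And>\<omega> t. \<omega> \<in> space M \<Longrightarrow> is_equilibrium (f \<omega> t) (r \<omega> t) (xbar t \<omega>)"
    and "0 < \<eta>" and "\<eta> \<le> 1 / (2 * L)"
    and "\<And>\<omega> t. \<omega> \<in> space M \<Longrightarrow> x (Suc t) \<omega> \<in> prox \<eta> (r \<omega> t) (x t \<omega> - \<eta> *\<^sub>R g t \<omega>)"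
    and "\<And>\<omega> t. \<omega> \<in> space M \<Longrightarrow> z t \<omega> = gradient (f \<omega> t (x t \<omega>)) (x t \<omega>) - g t \<omega>"
    and "\<And>t. x t \<in> borel_measurable (F t)"
    and "\<And>t. xbar t \<in> borel_measurable (F t)"
    and "\<And>t. z t \<in> borel_measurable (F (Suc t))"
    and "\<And>t. AE \<omega> in M. vec_cond_exp M (F t) (z t) \<omega> = 0"
    and "\<Delta> > 0" and "\<sigma> > 0"
    and "\<And>t. (\<integral>\<^sup>+ \<omega>. ennreal ((norm (xbar t \<omega> - xbar (Suc t) \<omega>))\<^sup>2) \<partial>M) \<le> ennreal (\<Delta>\<^sup>2)"
    and "\<And>t. (\<integral>\<^sup>+ \<omega>. ennreal ((norm (z t \<omega>))\<^sup>2) \<partial>M) \<le> ennreal (\<sigma>\<^sup>2)"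
  shows "\<forall>t. \<forall>\<omega>\<^sub>0\<in>space M.
    (\<integral>\<^sup>+ \<omega>. ennreal ((norm (x t \<omega> - xbar t \<omega>))\<^sup>2) \<partial>M)
      \<le> ennreal ((1 - \<mu>bar * \<eta>) ^ t * (norm (x 0 \<omega>\<^sub>0 - xbar 0 \<omega>\<^sub>0))\<^sup>2
           + 2 * (\<eta> * \<sigma>\<^sup>2 / \<mu>bar + (\<Delta> / (\<mu>bar * \<eta>))\<^sup>2))"
proof -
  interpret prob_space M by fact
  note sub = assms(3) and sens = assms(10) and \<mu>bar = assms(12) and \<eta> = \<open>0 < \<eta>\<close>
  \<comment> \<open>A single outcome is enough to extract the deterministic facts
    \<open>0 \<le> \<gamma>\<close> and \<open>\<mu> \<le> L\<close>.\<close>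
  obtain w where w: "w \<in> space M"
    using not_empty by blast
  have \<gamma>0: "0 \<le> \<gamma>"
    by (rule decision_sensitivity_nonneg[OF sens w])
  have \<mu>bar_pos: "0 < \<mu>bar"
    using \<open>\<gamma> < \<mu>\<close> \<mu>bar by simp
  have L\<eta>: "L * \<eta> \<le> 1 / 2"
    using \<open>\<eta> \<le> 1 / (2 * L)\<close> \<open>L > 0\<close> by (simp add: field_simps)
  define \<epsilon> where "\<epsilon> = \<mu>bar * \<eta>"
  have \<epsilon>0: "0 < \<epsilon>"
    using \<mu>bar_pos \<eta> by (simp add: \<epsilon>_def)
  have "\<epsilon> \<le> L * \<eta>"
    using strong_convexity_le_lipschitz[OF assms(7,8)[OF w]] \<gamma>0 \<mu>bar \<eta>
    unfolding \<epsilon>_def by (intro mult_right_mono) auto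
  then have \<epsilon>1: "\<epsilon> \<le> 1"
    using L\<eta> by simp
  have xF [measurable]: "x t \<in> borel_measurable M" "xbar t \<in> borel_measurable M"
    and zM [measurable]: "z t \<in> borel_measurable M" for t
    using measurable_from_subalg[OF sub] assms(18,19,20) by blast+
  note zI = integrable_nonneg_of_nn_integral_le[OF _ _ assms(25), simplified]
  note dI = integrable_nonneg_of_nn_integral_le[OF _ _ assms(24), simplified]
  define D where "D t = (\<lambda>\<omega>. (norm (x t \<omega> - xbar t \<omega>))\<^sup>2)" for t
  define R where "R t = (\<lambda>\<omega>. (1 - \<epsilon>) * D t \<omega> + 2 * \<eta> * (z t \<omega> \<bullet> (x t \<omega> - xbar t \<omega>))
      + 2 * \<eta>\<^sup>2 * (norm (z t \<omega>))\<^sup>2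
      + (1 + 1 / \<epsilon>) * (norm (xbar t \<omega> - xbar (Suc t) \<omega>))\<^sup>2)" for t
  have D_meas [measurable]: "D t \<in> borel_measurable M" for t
    unfolding D_def by measurable
  have step: "D (Suc t) \<omega> \<le> R t \<omega>" if \<omega>: "\<omega> \<in> space M" for t \<omega>
  proof -
    have "x (Suc t) \<omega> \<in> prox \<eta> (r \<omega> t)
        (x t \<omega> - \<eta> *\<^sub>R (gradient (f \<omega> t (x t \<omega>)) (x t \<omega>) - z t \<omega>))"
      using assms(16)[OF \<omega>, of t] assms(17)[OF \<omega>, of t] by simp
    from prox_gradient_step[OF assms(7)[OF \<omega>] assms(8)[OF \<omega>] assms(9)[OF \<omega>]
        decision_sensitivity_bound[OF sens \<omega>] \<gamma>0 assms(13)[OF \<omega>] \<eta> L\<eta> this]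
    have "(1 + \<epsilon>) * (norm (x (Suc t) \<omega> - xbar t \<omega>))\<^sup>2
        \<le> (1 - \<epsilon>) * D t \<omega> + 2 * \<eta> * (z t \<omega> \<bullet> (x t \<omega> - xbar t \<omega>)) + 2 * \<eta>\<^sup>2 * (norm (z t \<omega>))\<^sup>2"
      unfolding \<epsilon>_def \<mu>bar D_def .
    \<comment> \<open>The old equilibrium \<open>xbar t\<close> is the intermediate point; its
      weight \<open>1 + \<epsilon>\<close> matches the left side of the one-step estimate.\<close>
    then show ?thesis
      using norm_diff_sq_young[OF \<epsilon>0, of "x (Suc t) \<omega>" "xbar (Suc t) \<omega>" "xbar t \<omega>"]
      unfolding R_def D_def by linarith
  qed
  \<comment> \<open>Triviality of \<open>F 0\<close> makes the initial error deterministic, so any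
    \<open>\<omega>\<^sub>0\<close> may represent it in the conclusion.\<close>
  have D0: "D 0 \<omega> = D 0 \<omega>'" if "\<omega> \<in> space M" "\<omega>' \<in> space M" for \<omega> \<omega>'
  proof -
    have "space (F 0) = space M"
      using sub by (simp add: subalgebra_def)
    then show ?thesis
      using measurable_trivial_sigma_constant[of _ "F 0" \<omega> \<omega>'] assms(4,18,19) that
      unfolding D_def by metis
  qed
  have R_int: "integrable M (R t)" if "integrable M (D t)" for t
    using that zI dI integrable_inner_of_sq[OF _ zM _ zI(1), of "\<lambda>\<omega>. x t \<omega> - xbar t \<omega>" t]
    unfolding R_def D_def by auto
  \<comment> \<open>Square integrability of the error is derived, not assumed: it starts constant,
    and \<open>R t\<close> dominates the next error.\<close>
  have D_int: "integrable M (D t)" for t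
  proof (induction t)
    case 0
    have "integrable M (\<lambda>_. D 0 w)"
      by simp
    then show ?case
      by (rule Bochner_Integration.integrable_cong[THEN iffD1, rotated -1]) (use D0[OF w] in auto)
  next
    case (Suc t)
    show ?case
    proof (rule Bochner_Integration.integrable_bound[OF R_int[OF Suc]])
      show "AE \<omega> in M. norm (D (Suc t) \<omega>) \<le> norm (R t \<omega>)"
        using step[of _ t] by (auto intro!: AE_I2 simp: D_def) (meson abs_ge_self order_trans)
    qed measurable
  qed
  define e where "e t = (\<integral>\<omega>. D t \<omega> \<partial>M)" for t
  define c where "c = 2 * \<eta>\<^sup>2 * \<sigma>\<^sup>2 + (1 + 1 / \<epsilon>) * \<Delta>\<^sup>2"
  have e_step: "e (Suc t) \<le> (1 - \<epsilon>) * e t + c" for t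
  proof -
    \<comment> \<open>Measurability with respect to \<open>F t\<close>, not merely \<open>M\<close>,
      is what makes the cross term vanish.\<close>
    have Y: "(\<lambda>\<omega>. x t \<omega> - xbar t \<omega>) \<in> borel_measurable (F t)"
      using assms(18,19) by measurable
    have zero: "(\<integral>\<omega>. z t \<omega> \<bullet> (x t \<omega> - xbar t \<omega>) \<partial>M) = 0"
      using integral_inner_cond_exp_zero[OF sub Y zM _ zI(1) assms(21)] D_int[of t]
      by (simp add: D_def)
    have inner_int: "integrable M (\<lambda>\<omega>. z t \<omega> \<bullet> (x t \<omega> - xbar t \<omega>))"
      using integrable_inner_of_sq[OF _ zM _ zI(1), of "\<lambda>\<omega>. x t \<omega> - xbar t \<omega>" t] D_int[of t]
      by (simp add: D_def)
    have "e (Suc t) \<le> (\<integral>\<omega>. R t \<omega> \<partial>M)"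
      unfolding e_def using step D_int R_int by (intro integral_mono) auto
    also have "\<dots> = (1 - \<epsilon>) * e t + 2 * \<eta>\<^sup>2 * (\<integral>\<omega>. (norm (z t \<omega>))\<^sup>2 \<partial>M)
        + (1 + 1 / \<epsilon>) * (\<integral>\<omega>. (norm (xbar t \<omega> - xbar (Suc t) \<omega>))\<^sup>2 \<partial>M)"
      unfolding R_def e_def using D_int[of t] inner_int zI(1)[of t] dI(1)[of t] zero by simp
    also have "\<dots> \<le> (1 - \<epsilon>) * e t + 2 * \<eta>\<^sup>2 * \<sigma>\<^sup>2 + (1 + 1 / \<epsilon>) * \<Delta>\<^sup>2"
      using zI(2)[of t] dI(2)[of t] \<epsilon>0 \<epsilon>1 by (intro add_mono mult_left_mono) auto
    finally show ?thesis
      by (simp add: c_def)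
  qed
  let ?B = "2 * (\<eta> * \<sigma>\<^sup>2 / \<mu>bar + (\<Delta> / \<epsilon>)\<^sup>2)"
  \<comment> \<open>This places \<open>?B\<close> above the fixed point
    \<open>c / \<epsilon>\<close> of the recursion. The noise parts agree exactly; the slack is in
    the drift, where \<open>1 \<le> 1 / \<epsilon>\<close>.\<close>
  have "c \<le> \<epsilon> * ?B"
  proof -
    have "\<epsilon> * ?B = 2 * \<eta>\<^sup>2 * \<sigma>\<^sup>2 + (2 / \<epsilon>) * \<Delta>\<^sup>2"
      using \<epsilon>0 \<mu>bar_pos by (simp add: field_simps power2_eq_square) (simp add: \<epsilon>_def)
    moreover have "(1 + 1 / \<epsilon>) * \<Delta>\<^sup>2 \<le> (2 / \<epsilon>) * \<Delta>\<^sup>2"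
      using \<epsilon>0 \<epsilon>1 by (intro mult_right_mono) (auto simp: field_simps)
    ultimately show ?thesis
      by (simp add: c_def)
  qed
  then have fix_pt: "(1 - \<epsilon>) * ?B + c \<le> ?B"
    unfolding left_diff_distrib by simp
  have B0: "0 \<le> ?B"
    using \<eta> \<mu>bar_pos by simp
  have e_bound: "e t \<le> (1 - \<epsilon>) ^ t * e 0 + ?B" for t
    using contraction_recursion_bound[where e = e, OF refl e_step _ fix_pt B0] \<epsilon>1 by simp
  have e0: "e 0 = D 0 \<omega>\<^sub>0" if "\<omega>\<^sub>0 \<in> space M" for \<omega>\<^sub>0
  proof -
    have "e 0 = (\<integral>\<omega>. D 0 \<omega>\<^sub>0 \<partial>M)"
      unfolding e_def by (intro Bochner_Integration.integral_cong refl D0 that)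
    then show ?thesis
      by (simp add: prob_space)
  qed
  \<comment> \<open>Integrability lets the bound on \<open>e t\<close> be read as one on the
    nonnegative integral, so finiteness is part of the conclusion.\<close>
  have nn: "(\<integral>\<^sup>+ \<omega>. ennreal (D t \<omega>) \<partial>M) = ennreal (e t)" for t
    unfolding e_def using D_int[of t] by (intro nn_integral_eq_integral) (auto simp: D_def)
  have "(\<integral>\<^sup>+ \<omega>. ennreal (D t \<omega>) \<partial>M) \<le> ennreal ((1 - \<epsilon>) ^ t * D 0 \<omega>\<^sub>0 + ?B)"
    if "\<omega>\<^sub>0 \<in> space M" for t \<omega>\<^sub>0
    unfolding nn using e_bound[of t] e0[OF that] by (simp only: ennreal_leI)
  then show ?thesis
    unfolding D_def \<epsilon>_def by blast
qed

end
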